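(* Let $(M,\phi,\xi,\eta,g)$ be a $(2n+1)$-dimensional Kenmotsu manifold with a generalized symmetric metric connection $\bar\nabla$ of type $(\alpha,\beta)$, with Ricci tensor $\bar S$ and $W_2$-curvature tensor $\bar W_2$. If $(g,\xi,\lambda,\mu)$ is an $\eta$-Ricci soliton on $M$ (with respect to $\bar\nabla$) and $\bar W_2(\xi,X)\cdot\bar S=0$, i.e. $$\bar S(\bar W_2(\xi,X)Y,Z)+\bar S(Y,\bar W_2(\xi,X)Z)=0$$ for all vector fields $X,Y,Z$ on $M$, then $$(\alpha+1-\mu)\bigl(-2\mu-2\lambda+(4\alpha+4)n\bigr)=0.$$
   Context: An almost contact metric manifold is a smooth manifold $M$ of odd dimension with a $(1,1)$-tensor field $\phi$, a vector field $\xi$, a 1-form $\eta$ and a Riemannian metric $g$ such that $\phi\xi=0$, $\eta(\phi X)=0$, $\eta(\xi)=1$, $\phi^2X=-X+\eta(X)\xi$, $g(\phi X,\phi Y)=g(X,Y)-\eta(X)\eta(Y)$, $g(X,\xi)=\eta(X)$. It is a Kenmotsu manifold if, with $\nabla$ the Levi-Civita connection, $(\nabla_X\phi)Y=g(\phi X,Y)\xi-\eta(Y)\phi X$ and $\nabla_X\xi=X-\eta(X)\xi$. For smooth functions $\alpha,\beta$ on $M$, the generalized symmetric metric connection of type $(\alpha,\beta)$ is the linear connection $\bar\nabla$ with $\bar\nabla g=0$ and torsion $T(X,Y)=\alpha\{\eta(Y)X-\eta(X)Y\}+\beta\{\eta(Y)\phi X-\eta(X)\phi Y\}$; explicitly $\bar\nabla_XY=\nabla_XY+\alpha\{\eta(Y)X-g(X,Y)\xi\}-\beta\eta(X)\phi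 Y$. Its curvature tensor is $\bar R(X,Y)Z=\bar\nabla_X\bar\nabla_YZ-\bar\nabla_Y\bar\nabla_XZ-\bar\nabla_{[X,Y]}Z$, its Ricci tensor is $\bar S(Y,Z)=\operatorname{trace}(X\mapsto\bar R(X,Y)Z)$, and its Ricci operator $\bar Q$ is defined by $g(\bar QX,Y)=\bar S(X,Y)$. The $W_2$-curvature tensor of $\bar\nabla$ is $\bar W_2(X,Y)Z=\bar R(X,Y)Z+\frac{1}{\dim M-1}\bigl[g(X,Z)\bar QY-g(Y,Z)\bar QX\bigr]$. For real constants $\lambda,\mu$, the data $(g,\xi,\lambda,\mu)$ is an $\eta$-Ricci soliton on $M$ if $\mathcal L_\xi g+2\bar S+2\lambda g+2\mu\,\eta\otimes\eta=0$, where $\mathcal L_\xi g$ is written in terms of $\bar\nabla$, i.e. $2\bar S(X,Y)=-g(\bar\nabla_X\xi,Y)-g(X,\bar\nabla_Y\xi)-2\lambda g(X,Y)-2\mu\eta(X)\eta(Y)$ for all vector fields $X,Y$. *)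

theory Defs
  imports "HOL-Analysis.Analysis"
begin

section \<open>Smooth functions on open subsets of Euclidean spaces\<close>

(* Only meant for open S, where a map is C^(k+1) iff it is differentiable and all its
   directional derivatives along fixed vectors are C^k. *)
primrec Ck_on :: "nat \<Rightarrow> 'a::euclidean_space set \<Rightarrow> ('a \<Rightarrow> 'b::real_normed_vector) \<Rightarrow> bool" where
  "Ck_on 0 S = (\<lambda>f. continuous_on S f)"
| "Ck_on (Suc k) S = (\<lambda>f. (\<forall>x\<in>S. f differentiable (at x)) \<and>
      (\<forall>v. Ck_on k S (\<lambda>x. frechet_derivative f (at x) v)))"

definition smooth_on :: "'a::euclidean_space set \<Rightarrow> ('a \<Rightarrow> 'b::real_normed_vector) \<Rightarrow> bool" where
  "smooth_on S f \<longleftrightarrow> (\<forall>k. Ck_on k S f)"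

section \<open>Smooth manifolds, tangent vectors and vector fields\<close>

(* A chart is a pair (U, psi) of a domain and a coordinate map; psi is irrelevant outside U. *)
type_synonym ('a, 'm) chart = "'a set \<times> ('a \<Rightarrow> real ^ 'm)"

abbreviation chart_dom :: "('a, 'm::finite) chart \<Rightarrow> 'a set" where
  "chart_dom c \<equiv> fst c"

abbreviation chart_map :: "('a, 'm::finite) chart \<Rightarrow> 'a \<Rightarrow> real ^ 'm" where
  "chart_map c \<equiv> snd c"

abbreviation chart_image :: "('a, 'm::finite) chart \<Rightarrow> (real ^ 'm) set" where
  "chart_image c \<equiv> chart_map c ` chart_dom c"

abbreviation chart_inv :: "('a, 'm::finite) chart \<Rightarrow> real ^ 'm \<Rightarrow> 'a" where
  "chart_inv c \<equiv> inv_into (chart_dom c) (chart_map c)"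

(* The manifold is the whole type 'a, its dimension is CARD('m), and A is an atlas
   (not necessarily maximal). *)
definition smooth_manifold ::
    "('a::{t2_space, second_countable_topology}, 'm::finite) chart set \<Rightarrow> bool" where
  "smooth_manifold A \<longleftrightarrow>
     (\<forall>c\<in>A. open (chart_dom c) \<and> open (chart_image c) \<and>
        homeomorphism (chart_dom c) (chart_image c) (chart_map c) (chart_inv c)) \<and>
     (\<forall>p. \<exists>c\<in>A. p \<in> chart_dom c) \<and>
     (\<forall>c\<in>A. \<forall>d\<in>A.
        smooth_on (chart_map c ` (chart_dom c \<inter> chart_dom d)) (chart_map d \<circ> chart_inv c))"

(* A reference chart around p. The tangent space at p is real^'m: a tangent vector is
   given by its components in the reference chart at p. *)
definition chart_at :: "('a, 'm::finite) chart set \<Rightarrow> 'a \<Rightarrow> ('a, 'm) chart" where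
  "chart_at A p = (SOME c. c \<in> A \<and> p \<in> chart_dom c)"

definition smooth_fun :: "('a, 'm::finite) chart set \<Rightarrow> ('a \<Rightarrow> real) \<Rightarrow> bool" where
  "smooth_fun A f \<longleftrightarrow> (\<forall>c\<in>A. smooth_on (chart_image c) (f \<circ> chart_inv c))"

(* The derivative v(f) of f along the tangent vector v at p. *)
definition tangent_deriv :: "('a, 'm::finite) chart set \<Rightarrow> 'a \<Rightarrow> real ^ 'm \<Rightarrow> ('a \<Rightarrow> real) \<Rightarrow> real" where
  "tangent_deriv A p v f =
     frechet_derivative (f \<circ> chart_inv (chart_at A p)) (at (chart_map (chart_at A p) p)) v"

(* The components in the chart c of the tangent vector v at p. *)
definition components ::
    "('a, 'm::finite) chart set \<Rightarrow> ('a, 'm) chart \<Rightarrow> 'a \<Rightarrow> real ^ 'm \<Rightarrow> real ^ 'm" where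
  "components A c p v =
     frechet_derivative (chart_map c \<circ> chart_inv (chart_at A p)) (at (chart_map (chart_at A p) p)) v"

type_synonym ('a, 'm) field = "'a \<Rightarrow> real ^ 'm"

(* Smooth vector fields: in every chart the component functions are smooth. *)
definition vector_field :: "('a, 'm::finite) chart set \<Rightarrow> ('a, 'm) field \<Rightarrow> bool" where
  "vector_field A X \<longleftrightarrow>
     (\<forall>c\<in>A. smooth_on (chart_image c)
        (\<lambda>x. components A c (chart_inv c x) (X (chart_inv c x))))"

definition field_deriv ::
    "('a, 'm::finite) chart set \<Rightarrow> ('a, 'm) field \<Rightarrow> ('a \<Rightarrow> real) \<Rightarrow> 'a \<Rightarrow> real" where
  "field_deriv A X f p = tangent_deriv A p (X p) f"

(* [X,Y] f = X (Y f) - Y (X f) *)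
definition lie_bracket ::
    "('a, 'm::finite) chart set \<Rightarrow> ('a, 'm) field \<Rightarrow> ('a, 'm) field \<Rightarrow> ('a, 'm) field" where
  "lie_bracket A X Y p = (THE v. \<forall>f. smooth_fun A f \<longrightarrow>
     tangent_deriv A p v f =
       field_deriv A X (field_deriv A Y f) p - field_deriv A Y (field_deriv A X f) p)"

section \<open>Tensor fields, metrics and connections\<close>

definition one_form :: "('a, 'm::finite) chart set \<Rightarrow> ('a \<Rightarrow> real ^ 'm \<Rightarrow> real) \<Rightarrow> bool" where
  "one_form A \<eta> \<longleftrightarrow> (\<forall>p. linear (\<eta> p)) \<and>
     (\<forall>X. vector_field A X \<longrightarrow> smooth_fun A (\<lambda>p. \<eta> p (X p)))"

definition endo_field :: "('a, 'm::finite) chart set \<Rightarrow> ('a \<Rightarrow> real ^ 'm \<Rightarrow> real ^ 'm) \<Rightarrow> bool" where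
  "endo_field A \<phi> \<longleftrightarrow> (\<forall>p. linear (\<phi> p)) \<and>
     (\<forall>X. vector_field A X \<longrightarrow> vector_field A (\<lambda>p. \<phi> p (X p)))"

definition riemannian_metric ::
    "('a, 'm::finite) chart set \<Rightarrow> ('a \<Rightarrow> real ^ 'm \<Rightarrow> real ^ 'm \<Rightarrow> real) \<Rightarrow> bool" where
  "riemannian_metric A g \<longleftrightarrow>
     (\<forall>p. bilinear (g p)) \<and>
     (\<forall>p v w. g p v w = g p w v) \<and>
     (\<forall>p v. v \<noteq> 0 \<longrightarrow> g p v v > 0) \<and>
     (\<forall>X Y. vector_field A X \<and> vector_field A Y \<longrightarrow> smooth_fun A (\<lambda>p. g p (X p) (Y p)))"

type_synonym ('a, 'm) connection = "('a, 'm) field \<Rightarrow> ('a, 'm) field \<Rightarrow> ('a, 'm) field"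

(* D X Y is the covariant derivative of Y along X; values of D on arguments that are not
   smooth vector fields are irrelevant. *)
definition linear_connection :: "('a, 'm::finite) chart set \<Rightarrow> ('a, 'm) connection \<Rightarrow> bool" where
  "linear_connection A D \<longleftrightarrow>
     (\<forall>X Y. vector_field A X \<and> vector_field A Y \<longrightarrow> vector_field A (D X Y)) \<and>
     (\<forall>X X' Y. vector_field A X \<and> vector_field A X' \<and> vector_field A Y \<longrightarrow>
        D (\<lambda>p. X p + X' p) Y = (\<lambda>p. D X Y p + D X' Y p)) \<and>
     (\<forall>f X Y. smooth_fun A f \<and> vector_field A X \<and> vector_field A Y \<longrightarrow>
        D (\<lambda>p. f p *\<^sub>R X p) Y = (\<lambda>p. f p *\<^sub>R D X Y p)) \<and>
     (\<forall>X Y Y'. vector_field A X \<and> vector_field A Y \<and> vector_field A Y' \<longrightarrow>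
        D X (\<lambda>p. Y p + Y' p) = (\<lambda>p. D X Y p + D X Y' p)) \<and>
     (\<forall>f X Y. smooth_fun A f \<and> vector_field A X \<and> vector_field A Y \<longrightarrow>
        D X (\<lambda>p. f p *\<^sub>R Y p) = (\<lambda>p. field_deriv A X f p *\<^sub>R Y p + f p *\<^sub>R D X Y p))"

definition metric_compatible ::
    "('a, 'm::finite) chart set \<Rightarrow> ('a \<Rightarrow> real ^ 'm \<Rightarrow> real ^ 'm \<Rightarrow> real) \<Rightarrow> ('a, 'm) connection \<Rightarrow> bool" where
  "metric_compatible A g D \<longleftrightarrow>
     (\<forall>X Y Z p. vector_field A X \<and> vector_field A Y \<and> vector_field A Z \<longrightarrow>
        field_deriv A X (\<lambda>q. g q (Y q) (Z q)) p = g p (D X Y p) (Z p) + g p (Y p) (D X Z p))"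

definition torsion ::
    "('a, 'm::finite) chart set \<Rightarrow> ('a, 'm) connection \<Rightarrow> ('a, 'm) field \<Rightarrow> ('a, 'm) field \<Rightarrow> ('a, 'm) field" where
  "torsion A D X Y p = D X Y p - D Y X p - lie_bracket A X Y p"

definition levi_civita ::
    "('a, 'm::finite) chart set \<Rightarrow> ('a \<Rightarrow> real ^ 'm \<Rightarrow> real ^ 'm \<Rightarrow> real) \<Rightarrow> ('a, 'm) connection \<Rightarrow> bool" where
  "levi_civita A g D \<longleftrightarrow> linear_connection A D \<and> metric_compatible A g D \<and>
     (\<forall>X Y p. vector_field A X \<and> vector_field A Y \<longrightarrow> torsion A D X Y p = 0)"

definition curvature ::
    "('a, 'm::finite) chart set \<Rightarrow> ('a, 'm) connection \<Rightarrow>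
       ('a, 'm) field \<Rightarrow> ('a, 'm) field \<Rightarrow> ('a, 'm) field \<Rightarrow> ('a, 'm) field" where
  "curvature A D X Y Z p = D X (D Y Z) p - D Y (D X Z) p - D (lie_bracket A X Y) Z p"

(* The endomorphism of the tangent space at p induced by a map F of vector fields that is
   linear over the smooth functions (i.e. by a (1,1)-tensor field). *)
definition endo_at ::
    "('a, 'm::finite) chart set \<Rightarrow> (('a, 'm) field \<Rightarrow> ('a, 'm) field) \<Rightarrow> 'a \<Rightarrow> real ^ 'm \<Rightarrow> real ^ 'm" where
  "endo_at A F p = (THE L. linear L \<and> (\<forall>X. vector_field A X \<longrightarrow> F X p = L (X p)))"

(* S(Y,Z) = trace (X |-> R(X,Y)Z) *)
definition ricci ::
    "('a, 'm::finite) chart set \<Rightarrow> ('a, 'm) connection \<Rightarrow> ('a, 'm) field \<Rightarrow> ('a, 'm) field \<Rightarrow> 'a \<Rightarrow> real" where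
  "ricci A D Y Z p = trace (matrix (endo_at A (\<lambda>X. curvature A D X Y Z) p))"

(* g(QX,Y) = S(X,Y) *)
definition ricci_operator ::
    "('a, 'm::finite) chart set \<Rightarrow> ('a \<Rightarrow> real ^ 'm \<Rightarrow> real ^ 'm \<Rightarrow> real) \<Rightarrow> ('a, 'm) connection \<Rightarrow>
       ('a, 'm) field \<Rightarrow> ('a, 'm) field" where
  "ricci_operator A g D X = (THE W. vector_field A W \<and>
     (\<forall>Y p. vector_field A Y \<longrightarrow> g p (W p) (Y p) = ricci A D X Y p))"

(* Meaningful in dimension CARD('m) > 1. *)
definition W2_curvature ::
    "('a, 'm::finite) chart set \<Rightarrow> ('a \<Rightarrow> real ^ 'm \<Rightarrow> real ^ 'm \<Rightarrow> real) \<Rightarrow> ('a, 'm) connection \<Rightarrow>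
       ('a, 'm) field \<Rightarrow> ('a, 'm) field \<Rightarrow> ('a, 'm) field \<Rightarrow> ('a, 'm) field" where
  "W2_curvature A g D X Y Z p = curvature A D X Y Z p +
     (1 / (real CARD('m) - 1)) *\<^sub>R
       (g p (X p) (Z p) *\<^sub>R ricci_operator A g D Y p - g p (Y p) (Z p) *\<^sub>R ricci_operator A g D X p)"

section \<open>Kenmotsu manifolds\<close>

definition almost_contact_metric ::
    "('a::{t2_space, second_countable_topology}, 'm::finite) chart set \<Rightarrow>
       ('a \<Rightarrow> real ^ 'm \<Rightarrow> real ^ 'm) \<Rightarrow> ('a, 'm) field \<Rightarrow> ('a \<Rightarrow> real ^ 'm \<Rightarrow> real) \<Rightarrow>
       ('a \<Rightarrow> real ^ 'm \<Rightarrow> real ^ 'm \<Rightarrow> real) \<Rightarrow> bool" where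
  "almost_contact_metric A \<phi> \<xi> \<eta> g \<longleftrightarrow>
     smooth_manifold A \<and> odd CARD('m) \<and>
     endo_field A \<phi> \<and> vector_field A \<xi> \<and> one_form A \<eta> \<and> riemannian_metric A g \<and>
     (\<forall>p. \<phi> p (\<xi> p) = 0) \<and>
     (\<forall>p v. \<eta> p (\<phi> p v) = 0) \<and>
     (\<forall>p. \<eta> p (\<xi> p) = 1) \<and>
     (\<forall>p v. \<phi> p (\<phi> p v) = - v + \<eta> p v *\<^sub>R \<xi> p) \<and>
     (\<forall>p v w. g p (\<phi> p v) (\<phi> p w) = g p v w - \<eta> p v * \<eta> p w) \<and>
     (\<forall>p v. g p v (\<xi> p) = \<eta> p v)"

definition kenmotsu ::
    "('a::{t2_space, second_countable_topology}, 'm::finite) chart set \<Rightarrow>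
       ('a \<Rightarrow> real ^ 'm \<Rightarrow> real ^ 'm) \<Rightarrow> ('a, 'm) field \<Rightarrow> ('a \<Rightarrow> real ^ 'm \<Rightarrow> real) \<Rightarrow>
       ('a \<Rightarrow> real ^ 'm \<Rightarrow> real ^ 'm \<Rightarrow> real) \<Rightarrow> bool" where
  "kenmotsu A \<phi> \<xi> \<eta> g \<longleftrightarrow> almost_contact_metric A \<phi> \<xi> \<eta> g \<and>
     (\<exists>nabla. levi_civita A g nabla \<and>
        (\<forall>X Y p. vector_field A X \<and> vector_field A Y \<longrightarrow>
           nabla X (\<lambda>q. \<phi> q (Y q)) p - \<phi> p (nabla X Y p) =
             g p (\<phi> p (X p)) (Y p) *\<^sub>R \<xi> p - \<eta> p (Y p) *\<^sub>R \<phi> p (X p)) \<and>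
        (\<forall>X p. vector_field A X \<longrightarrow> nabla X \<xi> p = X p - \<eta> p (X p) *\<^sub>R \<xi> p))"

(* Characterises the connection uniquely on smooth vector fields: it is metric, and its
   torsion is prescribed. *)
definition generalized_symmetric_metric_connection ::
    "('a, 'm::finite) chart set \<Rightarrow> ('a \<Rightarrow> real ^ 'm \<Rightarrow> real ^ 'm) \<Rightarrow> ('a \<Rightarrow> real ^ 'm \<Rightarrow> real) \<Rightarrow>
       ('a \<Rightarrow> real ^ 'm \<Rightarrow> real ^ 'm \<Rightarrow> real) \<Rightarrow> ('a \<Rightarrow> real) \<Rightarrow> ('a \<Rightarrow> real) \<Rightarrow> ('a, 'm) connection \<Rightarrow> bool" where
  "generalized_symmetric_metric_connection A \<phi> \<eta> g \<alpha> \<beta> D \<longleftrightarrow>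
     linear_connection A D \<and> metric_compatible A g D \<and>
     (\<forall>X Y p. vector_field A X \<and> vector_field A Y \<longrightarrow>
        torsion A D X Y p =
          \<alpha> p *\<^sub>R (\<eta> p (Y p) *\<^sub>R X p - \<eta> p (X p) *\<^sub>R Y p) +
          \<beta> p *\<^sub>R (\<eta> p (Y p) *\<^sub>R \<phi> p (X p) - \<eta> p (X p) *\<^sub>R \<phi> p (Y p)))"

(* The sum of the first two summands is the Lie derivative of g along xi, written in terms
   of the connection D (which may have torsion). *)
definition eta_ricci_soliton ::
    "('a, 'm::finite) chart set \<Rightarrow> ('a, 'm) field \<Rightarrow> ('a \<Rightarrow> real ^ 'm \<Rightarrow> real) \<Rightarrow>
       ('a \<Rightarrow> real ^ 'm \<Rightarrow> real ^ 'm \<Rightarrow> real) \<Rightarrow> ('a, 'm) connection \<Rightarrow> real \<Rightarrow> real \<Rightarrow> bool" where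
  "eta_ricci_soliton A \<xi> \<eta> g D lam mu \<longleftrightarrow>
     (\<forall>X Y p. vector_field A X \<and> vector_field A Y \<longrightarrow>
        g p (D X \<xi> p) (Y p) + g p (X p) (D Y \<xi> p) + 2 * ricci A D X Y p +
          2 * lam * g p (X p) (Y p) + 2 * mu * \<eta> p (X p) * \<eta> p (Y p) = 0)"

end

theory Submission
  imports Defs
begin

text \<open>Write \<open>f = 1 + \<alpha>\<close> and \<open>c = \<xi> f + f\<close>. The connection satisfies
  \<open>D X \<xi> = f (X - \<eta>(X) \<xi>)\<close>, so the soliton equation becomes \<open>S = - (f + lam) g + (f - mu) \<eta> \<otimes> \<eta>\<close>,
  and \<open>R(\<xi>,X)\<xi> = c (X - \<eta>(X) \<xi>) - f \<beta> \<phi> X\<close>, whose trace gives \<open>lam + mu = 2 n c\<close>.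
  For \<open>X \<bottom> \<xi>\<close>, the condition \<open>S(W\<^sub>2(\<xi>,X)\<xi>, X) + S(\<xi>, W\<^sub>2(\<xi>,X)X) = 0\<close> then reduces to
  \<open>(f + lam) (f - mu) = 0\<close>. Since \<open>\<alpha>\<close> need not be constant, \<open>c\<close> still contains \<open>\<xi> f\<close>; but this
  equation leaves only two values for \<open>f\<close>, so \<open>f\<close> is locally constant by continuity, and \<open>c = f\<close>.\<close>

section \<open>Calculus of smooth maps\<close>

lemma frechet_derivative_eqI:
  "(f has_derivative f') (at x) \<Longrightarrow> frechet_derivative f (at x) = f'"
  using frechet_derivative_at by metis

text \<open>\<open>frechet_derivative\<close> is a choice over the predicate
  \<open>has_derivative\<close>, which only sees the germ of the map. The two choices therefore
  agree even where the maps are not differentiable.\<close>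

lemma frechet_derivative_cong_open:
  assumes "open S" "x \<in> S" "\<And>y. y \<in> S \<Longrightarrow> f y = g y"
  shows "frechet_derivative f (at x) = frechet_derivative g (at x)"
proof -
  have "(f has_derivative f') (at x) \<longleftrightarrow> (g has_derivative f') (at x)" for f'
    using has_derivative_transform_within_open[of f f' x UNIV S g]
      has_derivative_transform_within_open[of g f' x UNIV S f] assms by auto
  then show ?thesis
    by (simp add: frechet_derivative_def)
qed

lemma differentiable_cong_open:
  assumes "open S" "x \<in> S" "\<And>y. y \<in> S \<Longrightarrow> f y = g y" "f differentiable (at x)"
  shows "g differentiable (at x)"
  using assms has_derivative_transform_within_open[of f _ x UNIV S g]
  unfolding differentiable_def by blast

lemma Ck_on_cong:
  assumes "open S" "\<And>x. x \<in> S \<Longrightarrow> f x = g x" "Ck_on k S f"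
  shows "Ck_on k S g"
  using assms(2,3)
proof (induction k arbitrary: f g)
  case 0
  then show ?case by (metis Ck_on.simps(1) continuous_on_cong)
next
  case (Suc k)
  have "g differentiable (at x)" if "x \<in> S" for x
    using differentiable_cong_open[OF assms(1) that] Suc.prems that by auto
  moreover have "Ck_on k S (\<lambda>x. frechet_derivative g (at x) v)" for v
    by (rule Suc.IH[of "\<lambda>x. frechet_derivative f (at x) v"])
      (use Suc.prems frechet_derivative_cong_open[OF assms(1), of _ f g] in auto)
  ultimately show ?case by simp
qed

lemma Ck_on_subset: "Ck_on k T f \<Longrightarrow> S \<subseteq> T \<Longrightarrow> Ck_on k S f"
  by (induction k arbitrary: f) (auto intro: continuous_on_subset)

lemma Ck_on_Un:
  "open S \<Longrightarrow> open T \<Longrightarrow> Ck_on k S f \<Longrightarrow> Ck_on k T f \<Longrightarrow> Ck_on k (S \<union> T) f"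
  by (induction k arbitrary: f) (auto intro: continuous_on_open_Un)

lemma Ck_on_SucD: "Ck_on (Suc k) S f \<Longrightarrow> Ck_on k S f"
proof (induction k arbitrary: f)
  case 0
  then show ?case
    by (auto intro!: continuous_at_imp_continuous_on differentiable_imp_continuous_within)
next
  case (Suc k)
  then show ?case by (metis Ck_on.simps(2))
qed

lemma Ck_on_has_derivative:
  "Ck_on (Suc k) S f \<Longrightarrow> x \<in> S \<Longrightarrow> (f has_derivative frechet_derivative f (at x)) (at x)"
  by (simp add: frechet_derivative_works[symmetric])

text \<open>Lets the closure lemmas below name a derivative explicitly instead of handling the
  chosen \<open>frechet_derivative\<close>.\<close>

lemma Ck_on_SucI:
  assumes "open S" "\<And>x. x \<in> S \<Longrightarrow> (f has_derivative f' x) (at x)" "\<And>v. Ck_on k S (\<lambda>x. f' x v)"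
  shows "Ck_on (Suc k) S f"
proof -
  have "Ck_on k S (\<lambda>x. frechet_derivative f (at x) v)" for v
    using assms(1) _ assms(3)
  proof (rule Ck_on_cong)
    show "f' x v = frechet_derivative f (at x) v" if "x \<in> S" for x
      using frechet_derivative_eqI[OF assms(2)[OF that]] by simp
  qed
  then show ?thesis
    using assms(2) by (auto simp: differentiable_def)
qed

lemma Ck_on_const: "open S \<Longrightarrow> Ck_on k S (\<lambda>x. c)"
  by (induction k arbitrary: c)
    (auto intro: Ck_on_SucI has_derivative_const simp del: Ck_on.simps(2))

lemma Ck_on_linear:
  assumes "bounded_linear f" "open S"
  shows "Ck_on k S f"
proof (cases k)
  case 0
  then show ?thesis
    using assms by (simp add: linear_continuous_on)
next
  case (Suc j)
  then show ?thesis
    using Ck_on_SucI[OF assms(2) bounded_linear_imp_has_derivative[OF assms(1)]]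
      Ck_on_const[OF assms(2)] by blast
qed

lemma Ck_on_add:
  assumes "Ck_on k S f" "Ck_on k S g" "open S"
  shows "Ck_on k S (\<lambda>x. f x + g x)"
  using assms(1,2)
proof (induction k arbitrary: f g)
  case 0
  then show ?case by (simp add: continuous_on_add)
next
  case (Suc k)
  show ?case
  proof (rule Ck_on_SucI[OF assms(3)])
    show "((\<lambda>x. f x + g x) has_derivative
        (\<lambda>v. frechet_derivative f (at x) v + frechet_derivative g (at x) v)) (at x)"
      if "x \<in> S" for x
      by (rule has_derivative_add; rule Ck_on_has_derivative) (use Suc.prems that in auto)
  qed (rule Suc.IH; use Suc.prems in simp)
qed

lemma Ck_on_sum:
  assumes "finite I" "\<And>i. i \<in> I \<Longrightarrow> Ck_on k S (f i)" "open S"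
  shows "Ck_on k S (\<lambda>x. \<Sum>i\<in>I. f i x)"
  using assms by (induction I rule: finite_induct) (auto intro: Ck_on_const Ck_on_add)

text \<open>The Leibniz rule pairs each map with the derivative of the other, so the induction also
  uses both maps at the lower order.\<close>

lemma Ck_on_bilinear:
  assumes "bounded_bilinear h" "Ck_on k S f" "Ck_on k S g" "open S"
  shows "Ck_on k S (\<lambda>x. h (f x) (g x))"
  using assms(2,3)
proof (induction k arbitrary: f g)
  case 0
  then show ?case by (simp add: bounded_bilinear.continuous_on[OF assms(1)])
next
  case (Suc k)
  have "Ck_on k S f" "Ck_on k S g"
    using Suc.prems by (blast intro: Ck_on_SucD)+
  note IH = Suc.IH[OF this(1)] Suc.IH[OF _ this(2)]
  show ?case
  proof (rule Ck_on_SucI[OF assms(4)])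
    show "((\<lambda>x. h (f x) (g x)) has_derivative
        (\<lambda>v. h (f x) (frechet_derivative g (at x) v) + h (frechet_derivative f (at x) v) (g x))) (at x)"
      if "x \<in> S" for x
      by (rule bounded_bilinear.FDERIV[OF assms(1)]; rule Ck_on_has_derivative)
        (use Suc.prems that in auto)
  qed (rule Ck_on_add[OF _ _ assms(4)]; rule IH; use Suc.prems in simp)
qed

lemmas Ck_on_scaleR = Ck_on_bilinear[OF bounded_bilinear_scaleR]

lemma Ck_on_compose:
  fixes f :: "'a::euclidean_space \<Rightarrow> 'b::euclidean_space"
  assumes "open S" "f ` S \<subseteq> T" "Ck_on k S f" "Ck_on k T g"
  shows "Ck_on k S (g \<circ> f)"
  using assms(3,4)
proof (induction k arbitrary: g)
  case 0
  then show ?case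
    using assms(2) by (metis Ck_on.simps(1) continuous_on_compose continuous_on_subset)
next
  case (Suc k)
  \<comment> \<open>In the chain rule the derivative of \<open>g\<close> is applied to a direction
    that varies with \<open>x\<close>, while the induction hypothesis covers fixed directions only.
    Expanding the direction in \<open>Basis\<close> leaves a sum of products of C^k maps.\<close>
  let ?d = "\<lambda>x v. \<Sum>b\<in>Basis. (frechet_derivative f (at x) v \<bullet> b) *\<^sub>R
    ((\<lambda>y. frechet_derivative g (at y) b) \<circ> f) x"
  show ?case
  proof (rule Ck_on_SucI[OF assms(1)])
    show "((g \<circ> f) has_derivative ?d x) (at x)" if "x \<in> S" for x
    proof -
      have f: "(f has_derivative frechet_derivative f (at x)) (at x)"
        using Suc.prems(1) that by (rule Ck_on_has_derivative)
      have g: "(g has_derivative frechet_derivative g (at (f x))) (at (f x))"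
        using Suc.prems(2) that assms(2) by (intro Ck_on_has_derivative) auto
      have lin: "linear (frechet_derivative g (at (f x)))"
        using g by (rule has_derivative_linear)
      have "frechet_derivative g (at (f x)) w
          = (\<Sum>b\<in>Basis. (w \<bullet> b) *\<^sub>R frechet_derivative g (at (f x)) b)" for w
        using linear_sum[OF lin, of "\<lambda>b. (w \<bullet> b) *\<^sub>R b" Basis]
        unfolding linear_scale[OF lin] euclidean_representation .
      then have "frechet_derivative g (at (f x)) \<circ> frechet_derivative f (at x) = ?d x"
        unfolding comp_apply fun_eq_iff by blast
      then show ?thesis
        using diff_chain_at[OF f g] by simp
    qed
    show "Ck_on k S (\<lambda>x. ?d x v)" for v
    proof (intro Ck_on_sum Ck_on_scaleR assms(1))
      show "Ck_on k S (\<lambda>x. frechet_derivative f (at x) v \<bullet> b)" for b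
        using Suc.prems(1) assms(1)
        by (intro Ck_on_bilinear[OF bounded_bilinear_inner] Ck_on_const) auto
      show "Ck_on k S (\<lambda>x. ((\<lambda>y. frechet_derivative g (at y) b) \<circ> f) x)" for b
        using Suc.IH[OF Ck_on_SucD[OF Suc.prems(1)], of "\<lambda>y. frechet_derivative g (at y) b"]
          Suc.prems(2) by (simp add: o_def)
    qed simp
  qed
qed

section \<open>Bump functions\<close>

text \<open>At \<open>j = 0\<close> this is the classical flat function. The powers of
  \<open>t\<close> in the denominator make the family closed under differentiation up to linear
  combinations, so one induction covers all orders.\<close>

definition flat_exp :: "nat \<Rightarrow> real \<Rightarrow> real" where
  "flat_exp j t = (if t > 0 then exp (- 1 / t) / t ^ j else 0)"

text \<open>Passing to \<open>inverse t\<close> turns the limit from the right into that of a power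
  over the exponential at infinity.\<close>

lemma flat_exp_tendsto_0: "(flat_exp j \<longlongrightarrow> 0) (at 0)"
proof -
  have "((\<lambda>t::real. inverse t ^ j / exp (inverse t)) \<longlongrightarrow> 0) (at_right 0)"
    by (rule filterlim_compose[OF tendsto_power_div_exp_0 filterlim_inverse_at_top_right])
  then have "(flat_exp j \<longlongrightarrow> 0) (at_right 0)"
    by (rule filterlim_cong[OF refl refl, THEN iffD1, rotated])
      (auto simp: eventually_at_filter flat_exp_def exp_minus field_simps)
  moreover have "(flat_exp j \<longlongrightarrow> 0) (at_left 0)"
    by (rule filterlim_cong[OF refl refl, THEN iffD1, OF _ tendsto_const])
      (auto simp: eventually_at_filter flat_exp_def)
  ultimately show ?thesis
    by (simp add: filterlim_at_split)
qed

lemma flat_exp_has_derivative: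
  "(flat_exp j has_real_derivative flat_exp (j + 2) t - real j * flat_exp (Suc j) t) (at t)"
proof -
  consider "t > 0" | "t < 0" | "t = 0" by linarith
  then show ?thesis
  proof cases
    case 1
    have "((\<lambda>t. exp (- 1 / t) / t ^ j) has_real_derivative
        flat_exp (j + 2) t - real j * flat_exp (Suc j) t) (at t)"
      using 1 by (auto intro!: derivative_eq_intros simp: flat_exp_def divide_simps)
        (cases j; simp add: algebra_simps power2_eq_square)
    then show ?thesis
      by (rule DERIV_cong_ev[THEN iffD1, rotated -1])
        (use 1 eventually_nhds_in_open[of "{0<..}" t] in
          \<open>auto simp: flat_exp_def elim!: eventually_mono\<close>)
  next
    case 2
    have "((\<lambda>t. 0) has_real_derivative flat_exp (j + 2) t - real j * flat_exp (Suc j) t) (at t)"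
      using 2 by (simp add: flat_exp_def)
    then show ?thesis
      by (rule DERIV_cong_ev[THEN iffD1, rotated -1])
        (use 2 eventually_nhds_in_open[of "{..<0}" t] in
          \<open>auto simp: flat_exp_def elim!: eventually_mono\<close>)
  next
    case 3
    \<comment> \<open>At 0 the difference quotient is the member of the family with the next index,
      which tends to 0.\<close>
    have "(flat_exp j y - flat_exp j 0) / (y - 0) = flat_exp (Suc j) y" for y
      by (simp add: flat_exp_def)
    moreover have "flat_exp i 0 = 0" for i
      by (simp add: flat_exp_def)
    ultimately show ?thesis
      using flat_exp_tendsto_0[of "Suc j"] 3
      by (simp add: has_field_derivative_iff)
  qed
qed

lemma Ck_on_flat_exp: "Ck_on k UNIV (flat_exp j)"
proof (induction k arbitrary: j)
  case 0
  then show ?case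
    by (simp, rule DERIV_continuous_on, rule flat_exp_has_derivative)
next
  case (Suc k)
  have *: "(flat_exp j has_derivative (\<lambda>v. (flat_exp (j + 2) t - real j * flat_exp (Suc j) t) * v)) (at t)"
    for t
    using flat_exp_has_derivative by (simp add: has_field_derivative_def)
  have "Ck_on k UNIV (\<lambda>t. (flat_exp (j + 2) t + (- real j) * flat_exp (Suc j) t) * v)" for v
    by (intro Ck_on_bilinear[OF bounded_bilinear_mult] Ck_on_add Ck_on_const Suc.IH open_UNIV)
  then show ?case
    by (intro Ck_on_SucI[OF open_UNIV *]) (simp only: mult_minus_left diff_conv_add_uminus)
qed

text \<open>The function is positive exactly where the squared distance to \<open>x0\<close> is less
  than \<open>r\<close>.\<close>

lemma Ck_on_bump:
  fixes x0 :: "'a::euclidean_space"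
  shows "Ck_on k S (\<lambda>x. flat_exp 0 (r - (x - x0) \<bullet> (x - x0)))"
proof -
  have "Ck_on k UNIV (\<lambda>x. x + (- x0))"
    by (intro Ck_on_add Ck_on_linear Ck_on_const bounded_linear_ident open_UNIV)
  then have "Ck_on k UNIV (\<lambda>x. (x - x0) \<bullet> (x - x0))"
    by (intro Ck_on_bilinear[OF bounded_bilinear_inner]) auto
  then have "Ck_on k UNIV (\<lambda>x. r + (- 1) *\<^sub>R ((x - x0) \<bullet> (x - x0)))"
    by (intro Ck_on_add Ck_on_scaleR Ck_on_const) auto
  then have "Ck_on k UNIV (flat_exp 0 \<circ> (\<lambda>x. r - (x - x0) \<bullet> (x - x0)))"
    by (intro Ck_on_compose[of _ _ UNIV] Ck_on_flat_exp) auto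
  then show ?thesis
    by (auto simp: o_def intro: Ck_on_subset)
qed

section \<open>Smooth functions and vector fields on manifolds\<close>

context
  fixes A :: "('a::{t2_space, second_countable_topology}, 'm::finite) chart set"
  assumes M: "smooth_manifold A"
begin

section \<open>Charts and transition maps\<close>

lemma chart_at:
  "chart_at A p \<in> A" "p \<in> chart_dom (chart_at A p)"
proof -
  have "\<exists>c. c \<in> A \<and> p \<in> chart_dom c"
    using M unfolding smooth_manifold_def by blast
  then show "chart_at A p \<in> A" "p \<in> chart_dom (chart_at A p)"
    unfolding chart_at_def by (metis (mono_tags, lifting) someI_ex)+
qed

lemma chart_homeomorphism:
  assumes "c \<in> A"
  shows "open (chart_dom c)" "open (chart_image c)"
    "homeomorphism (chart_dom c) (chart_image c) (chart_map c) (chart_inv c)"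
  using M assms by (auto simp: smooth_manifold_def)

lemma chart_inv_map [simp]: "c \<in> A \<Longrightarrow> p \<in> chart_dom c \<Longrightarrow> chart_inv c (chart_map c p) = p"
  using chart_homeomorphism(3) by (meson homeomorphism_apply1)

lemma chart_map_inv [simp]: "x \<in> chart_image c \<Longrightarrow> chart_map c (chart_inv c x) = x"
  by (rule f_inv_into_f)

lemma chart_inv_in_dom [simp]: "x \<in> chart_image c \<Longrightarrow> chart_inv c x \<in> chart_dom c"
  by (rule inv_into_into)

lemma open_chart_map:
  assumes "c \<in> A" "open U"
  shows "open (chart_map c ` (chart_dom c \<inter> U))"
  using homeomorphism_imp_open_map[OF chart_homeomorphism(3)[OF assms(1)], of "chart_dom c \<inter> U"]
    chart_homeomorphism(2)[OF assms(1)] assms(2)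
  by (auto simp: openin_open_eq openin_open_Int)

lemma transition_Ck:
  assumes "c \<in> A" "d \<in> A"
  shows "Ck_on k (chart_map c ` (chart_dom c \<inter> chart_dom d)) (chart_map d \<circ> chart_inv c)"
  using M assms by (auto simp: smooth_manifold_def smooth_on_def)

lemma transition_has_derivative:
  assumes "c \<in> A" "d \<in> A" "p \<in> chart_dom c" "p \<in> chart_dom d"
  shows "((chart_map d \<circ> chart_inv c) has_derivative
    frechet_derivative (chart_map d \<circ> chart_inv c) (at (chart_map c p))) (at (chart_map c p))"
  using assms by (intro Ck_on_has_derivative[OF transition_Ck[of c d "Suc 0"]]) auto

lemma components_linear:
  assumes "c \<in> A" "p \<in> chart_dom c"
  shows "linear (components A c p)"
  using transition_has_derivative[OF chart_at(1) assms(1) chart_at(2) assms(2)]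
  by (auto simp: components_def[abs_def] intro: has_derivative_linear)

section \<open>Algebra of smooth functions and vector fields\<close>

lemma smooth_funD: "smooth_fun A f \<Longrightarrow> c \<in> A \<Longrightarrow> Ck_on k (chart_image c) (f \<circ> chart_inv c)"
  by (auto simp: smooth_fun_def smooth_on_def)

lemma vector_fieldD:
  "vector_field A X \<Longrightarrow> c \<in> A \<Longrightarrow>
    Ck_on k (chart_image c) (\<lambda>x. components A c (chart_inv c x) (X (chart_inv c x)))"
  by (auto simp: vector_field_def smooth_on_def)

lemma smooth_fun_const: "smooth_fun A (\<lambda>p. r)"
  using chart_homeomorphism(2) by (auto simp: smooth_fun_def smooth_on_def o_def intro: Ck_on_const)

lemma smooth_fun_add:
  assumes "smooth_fun A f" "smooth_fun A h"
  shows "smooth_fun A (\<lambda>p. f p + h p)"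
  using Ck_on_add[OF smooth_funD[OF assms(1)] smooth_funD[OF assms(2)]] chart_homeomorphism(2)
  by (auto simp: smooth_fun_def smooth_on_def o_def)

lemma smooth_fun_mult:
  assumes "smooth_fun A f" "smooth_fun A h"
  shows "smooth_fun A (\<lambda>p. f p * h p)"
  using Ck_on_bilinear[OF bounded_bilinear_mult smooth_funD[OF assms(1)] smooth_funD[OF assms(2)]]
    chart_homeomorphism(2)
  by (auto simp: smooth_fun_def smooth_on_def o_def)

lemma smooth_fun_uminus: "smooth_fun A f \<Longrightarrow> smooth_fun A (\<lambda>p. - f p)"
  using smooth_fun_mult[OF smooth_fun_const, of f "- 1"] by simp

lemma smooth_fun_diff: "smooth_fun A f \<Longrightarrow> smooth_fun A h \<Longrightarrow> smooth_fun A (\<lambda>p. f p - h p)"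
  using smooth_fun_add[OF _ smooth_fun_uminus, of f h] by simp

lemma vector_field_add:
  assumes "vector_field A X" "vector_field A Y"
  shows "vector_field A (\<lambda>p. X p + Y p)"
  unfolding vector_field_def smooth_on_def
proof (intro ballI allI)
  fix c k assume c: "c \<in> A"
  show "Ck_on k (chart_image c) (\<lambda>x. components A c (chart_inv c x)
      (X (chart_inv c x) + Y (chart_inv c x)))"
    by (rule Ck_on_cong[OF chart_homeomorphism(2)[OF c] _
        Ck_on_add[OF vector_fieldD[OF assms(1) c] vector_fieldD[OF assms(2) c]
          chart_homeomorphism(2)[OF c]]])
      (simp add: linear_add[OF components_linear[OF c chart_inv_in_dom]])
qed

lemma vector_field_scale:
  assumes "smooth_fun A f" "vector_field A X"
  shows "vector_field A (\<lambda>p. f p *\<^sub>R X p)"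
  unfolding vector_field_def smooth_on_def
proof (intro ballI allI)
  fix c k assume c: "c \<in> A"
  show "Ck_on k (chart_image c) (\<lambda>x. components A c (chart_inv c x)
      (f (chart_inv c x) *\<^sub>R X (chart_inv c x)))"
    by (rule Ck_on_cong[OF chart_homeomorphism(2)[OF c] _
        Ck_on_scaleR[OF smooth_funD[OF assms(1) c] vector_fieldD[OF assms(2) c]
          chart_homeomorphism(2)[OF c]]])
      (simp add: linear_scale[OF components_linear[OF c chart_inv_in_dom]])
qed

lemma vector_field_diff:
  assumes "vector_field A X" "vector_field A Y"
  shows "vector_field A (\<lambda>p. X p - Y p)"
  using vector_field_add[OF assms(1) vector_field_scale[OF smooth_fun_const assms(2), of "- 1"]]
  by simp

text \<open>The chain rule, with the transition from \<open>d\<close> to \<open>c\<close> factored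
  near \<open>q\<close> through the reference chart at \<open>q\<close>. The argument of
  \<open>components\<close> is the tangent vector at \<open>q\<close> whose coordinates in
  \<open>d\<close> are \<open>v\<close>.\<close>

lemma components_change_chart:
  assumes "c \<in> A" "d \<in> A" "q \<in> chart_dom c" "q \<in> chart_dom d"
  shows "components A c q (frechet_derivative (chart_map (chart_at A q) \<circ> chart_inv d) (at (chart_map d q)) v)
    = frechet_derivative (chart_map c \<circ> chart_inv d) (at (chart_map d q)) v"
proof -
  let ?e = "chart_at A q"
  have *: "((chart_map c \<circ> chart_inv ?e) \<circ> (chart_map ?e \<circ> chart_inv d) has_derivative
      components A c q \<circ> frechet_derivative (chart_map ?e \<circ> chart_inv d) (at (chart_map d q)))
      (at (chart_map d q))"
    using transition_has_derivative[OF chart_at(1) assms(1) chart_at(2) assms(3)]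
      transition_has_derivative[OF assms(2) chart_at(1) assms(4) chart_at(2)] assms
    by (intro diff_chain_at) (auto simp: components_def[abs_def])
  have "open (chart_map d ` (chart_dom d \<inter> chart_dom ?e))"
    using open_chart_map chart_homeomorphism(1) assms(2) chart_at(1) by blast
  then have "frechet_derivative ((chart_map c \<circ> chart_inv ?e) \<circ> (chart_map ?e \<circ> chart_inv d)) (at (chart_map d q))
      = frechet_derivative (chart_map c \<circ> chart_inv d) (at (chart_map d q))"
    by (rule frechet_derivative_cong_open) (use assms chart_at in auto)
  then show ?thesis
    using frechet_derivative_eqI[OF *] by (metis comp_apply)
qed

text \<open>Take the field with constant coordinates \<open>v\<close> in a chart around
  \<open>p\<close>, multiply it by a bump function and extend it by zero. This lets a tensor at
  \<open>p\<close> be determined by its values on global fields.\<close>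

lemma vector_field_through: "\<exists>X. vector_field A X \<and> X p = v"
proof -
  define d where "d = chart_at A p"
  have d: "d \<in> A" "p \<in> chart_dom d"
    using chart_at by (auto simp: d_def)
  define x0 where "x0 = chart_map d p"
  obtain r where r: "r > 0" "cball x0 r \<subseteq> chart_image d"
    using chart_homeomorphism(2)[OF d(1)] d(2) open_contains_cball unfolding x0_def
    by (metis imageI)
  define b where "b x = flat_exp 0 (r\<^sup>2 - (x - x0) \<bullet> (x - x0))" for x
  have b_outside: "b x = 0" if "x \<notin> cball x0 r" for x
  proof -
    have "r \<le> norm (x - x0)"
      using that by (simp add: dist_norm norm_minus_commute)
    then have "r\<^sup>2 \<le> (x - x0) \<bullet> (x - x0)"
      using r(1) by (simp add: power_mono flip: power2_norm_eq_inner)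
    then show ?thesis
      by (simp add: b_def flat_exp_def)
  qed
  have b_pos: "b x0 > 0"
    using r(1) by (simp add: b_def flat_exp_def)
  define K where "K = chart_inv d ` cball x0 r"
  \<comment> \<open>The set \<open>K\<close> is compact, hence closed because the space is
    Hausdorff. So the region where the field is extended by zero contains the open set
    \<open>- K\<close>.\<close>
  have "continuous_on (cball x0 r) (chart_inv d)"
    using chart_homeomorphism(3)[OF d(1)] r(2)
    by (meson continuous_on_subset homeomorphism_cont2)
  then have "closed K"
    unfolding K_def by (intro compact_imp_closed compact_continuous_image compact_cball)
  \<comment> \<open>The Frechet derivative turns coordinates in \<open>d\<close> into components in
    the reference chart at \<open>q\<close>; division by \<open>b x0\<close> normalises the value at
    \<open>p\<close> to \<open>v\<close>.\<close>
  define X where "X q = (if q \<in> chart_dom d then (b (chart_map d q) / b x0) *\<^sub>R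
      frechet_derivative (chart_map (chart_at A q) \<circ> chart_inv d) (at (chart_map d q)) v else 0)" for q
  have X_outside: "X q = 0" if "q \<notin> K" for q
  proof (cases "q \<in> chart_dom d")
    case True
    then have "chart_map d q \<notin> cball x0 r"
      using that d(1) chart_inv_map unfolding K_def by (metis imageI)
    then show ?thesis
      using b_outside by (simp add: X_def)
  qed (simp add: X_def)
  have "vector_field A X"
    unfolding vector_field_def smooth_on_def
  proof (intro ballI allI)
    fix c k assume c: "c \<in> A"
    let ?S = "chart_map c ` (chart_dom c \<inter> chart_dom d)"
    let ?T = "chart_map c ` (chart_dom c \<inter> (- K))"
    let ?D = "chart_map d ` (chart_dom d \<inter> chart_dom c)"
    let ?f = "\<lambda>x. components A c (chart_inv c x) (X (chart_inv c x))"
    let ?h = "\<lambda>y. (b y / b x0) *\<^sub>R frechet_derivative (chart_map c \<circ> chart_inv d) (at y) v"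
    have S: "open ?S" and D: "open ?D"
      using c d(1) chart_homeomorphism(1) open_chart_map by blast+
    have T: "open ?T"
      using c \<open>closed K\<close> open_chart_map by blast
    \<comment> \<open>The chart image is covered by two open sets: on \<open>?S\<close> the field is
      the bump formula transported from \<open>d\<close>, on \<open>?T\<close> it vanishes.
      Smoothness on each piece suffices.\<close>
    have "K \<subseteq> chart_dom d"
      using r(2) by (auto simp: K_def inv_into_into)
    then have eq: "chart_image c = ?S \<union> ?T"
      by blast
    have "Ck_on k ?D ?h"
    proof (intro Ck_on_scaleR D)
      have "Ck_on k ?D (\<lambda>y. b y * (1 / b x0))"
        unfolding b_def by (intro Ck_on_bilinear[OF bounded_bilinear_mult] Ck_on_bump Ck_on_const D)
      then show "Ck_on k ?D (\<lambda>y. b y / b x0)"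
        by simp
      show "Ck_on k ?D (\<lambda>y. frechet_derivative (chart_map c \<circ> chart_inv d) (at y) v)"
        using transition_Ck[OF d(1) c, of "Suc k"] by simp
    qed
    then have "Ck_on k ?S (?h \<circ> (chart_map d \<circ> chart_inv c))"
      by (intro Ck_on_compose[OF S _ transition_Ck[OF c d(1)]]) (use c in auto)
    then have "Ck_on k ?S ?f"
    proof (rule Ck_on_cong[OF S, rotated])
      fix x assume "x \<in> ?S"
      then obtain q where q: "q \<in> chart_dom c" "q \<in> chart_dom d" "x = chart_map c q"
        by blast
      then show "(?h \<circ> (chart_map d \<circ> chart_inv c)) x = ?f x"
        using c d(1) components_change_chart[OF c d(1) q(1,2)]
        by (simp add: X_def linear_scale[OF components_linear])
    qed
    moreover have "Ck_on k ?T ?f"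
    proof (rule Ck_on_cong[OF T _ Ck_on_const[OF T]])
      fix x assume "x \<in> ?T"
      then obtain q where "q \<in> chart_dom c" "q \<notin> K" "x = chart_map c q"
        by blast
      then show "0 = ?f x"
        using c X_outside linear_0[OF components_linear] by simp
    qed
    ultimately show "Ck_on k (chart_image c) ?f"
      unfolding eq by (intro Ck_on_Un S T)
  qed
  moreover have "X p = v"
  proof -
    have "frechet_derivative (chart_map d \<circ> chart_inv d) (at x0) = frechet_derivative (\<lambda>x. x) (at x0)"
      using d by (intro frechet_derivative_cong_open[OF chart_homeomorphism(2)]) (auto simp: x0_def)
    also have "\<dots> = (\<lambda>x. x)"
      by (rule frechet_derivative_eqI) (rule has_derivative_ident)
    finally show ?thesis
      using b_pos d by (simp add: X_def x0_def[symmetric] d_def[symmetric])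
  qed
  ultimately show ?thesis
    by blast
qed

text \<open>By continuity the function avoids the value \<open>r\<close> near \<open>p\<close> when
  \<open>r\<close> differs from \<open>f p\<close>, so it is locally constant there.\<close>

lemma field_deriv_two_valued:
  assumes "smooth_fun A f"
    and "\<And>q. f q = f p \<or> f q = r"
  shows "field_deriv A X f p = 0"
proof -
  define c where "c = chart_at A p"
  have c: "c \<in> A" "p \<in> chart_dom c"
    using chart_at by (auto simp: c_def)
  let ?f = "f \<circ> chart_inv c"
  have "continuous_on (chart_image c) ?f"
    using smooth_funD[OF assms(1) c(1), of 0] by (simp only: Ck_on.simps)
  have "\<forall>\<^sub>F x in nhds (chart_map c p). ?f x = ?f (chart_map c p)"
  proof (cases "f p = r")
    case True
    then show ?thesis using assms(2) c by auto
  next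
    case False
    have "open ((?f -` (- {r})) \<inter> chart_image c)"
      using \<open>continuous_on (chart_image c) ?f\<close> chart_homeomorphism(2)[OF c(1)]
      by (metis continuous_on_open_vimage open_Compl closed_singleton)
    then show ?thesis
      unfolding eventually_nhds using False c
      by (intro exI[of _ "(?f -` (- {r})) \<inter> chart_image c"]) (auto, metis assms(2))
  qed
  then obtain S where S: "open S" "chart_map c p \<in> S" "\<And>x. x \<in> S \<Longrightarrow> ?f x = ?f (chart_map c p)"
    by (auto simp: eventually_nhds)
  have "frechet_derivative ?f (at (chart_map c p))
      = frechet_derivative (\<lambda>x. ?f (chart_map c p)) (at (chart_map c p))"
    using S by (rule frechet_derivative_cong_open)
  also have "\<dots> = (\<lambda>v. 0)"
    by (rule frechet_derivative_eqI) (rule has_derivative_const)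
  finally show ?thesis
    by (simp add: field_deriv_def tangent_deriv_def c_def)
qed

lemma field_deriv_const: "field_deriv A X (\<lambda>p. r) p = 0"
  using field_deriv_two_valued[OF smooth_fun_const] by simp

end

section \<open>Traces\<close>

lemma trace_matrix: "trace (matrix L) = (\<Sum>i\<in>UNIV. L (axis i 1) $ i)"
  by (simp add: trace_def matrix_def)

lemma linear_basis_expansion:
  fixes h :: "real ^ 'm::finite \<Rightarrow> 'b::real_vector"
  assumes "linear h"
  shows "h v = (\<Sum>i\<in>UNIV. v $ i *\<^sub>R h (axis i 1))"
proof -
  have "h (\<Sum>i\<in>UNIV. v $ i *\<^sub>R axis i 1) = (\<Sum>i\<in>UNIV. v $ i *\<^sub>R h (axis i 1))"
    by (simp add: linear_sum[OF assms] linear_scale[OF assms])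
  then show ?thesis
    using basis_expansion[of v] by (simp add: scalar_mult_eq_scaleR)
qed

text \<open>With \<open>G\<close> the Gram matrix of \<open>g\<close>, skewness reads
  \<open>transpose ?L ** G = - (G ** ?L)\<close>. Hence \<open>?L\<close> is similar to the negative
  of its transpose, and its trace equals its own negative.\<close>

lemma trace_skew_adjoint:
  fixes g :: "real ^ 'm::finite \<Rightarrow> real ^ 'm \<Rightarrow> real"
  assumes "bilinear g" "\<And>v. v \<noteq> 0 \<Longrightarrow> g v v > 0" "linear L"
    and skew: "\<And>v w. g (L v) w = - g v (L w)"
  shows "trace (matrix L) = 0"
proof -
  define G :: "real ^ 'm ^ 'm" where "G = (\<chi> i j. g (axis i 1) (axis j 1))"
  let ?L = "matrix L"
  have l: "linear (\<lambda>v. g v w)" and r: "linear (g v)" for v w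
    using assms(1) by (auto simp: bilinear_def)
  have g: "g v w = v \<bullet> (G *v w)" for v w
  proof -
    have "g v w = (\<Sum>i\<in>UNIV. v $ i * g (axis i 1) w)"
      using linear_basis_expansion[OF l, where v = v] by simp
    also have "\<dots> = (\<Sum>i\<in>UNIV. v $ i * (\<Sum>j\<in>UNIV. g (axis i 1) (axis j 1) * w $ j))"
      using linear_basis_expansion[OF r, where v = w] by (simp add: mult.commute)
    finally show ?thesis
      by (simp add: inner_vec_def matrix_vector_mult_def G_def)
  qed
  have L: "L v = ?L *v v" for v
    using assms(3) by simp
  \<comment> \<open>Positivity makes \<open>G\<close> injective, hence invertible.\<close>
  have "w = 0" if "G *v w = 0" for w
    using assms(2)[of w] that by (force simp: g)
  then obtain H where H: "H ** G = mat 1"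
    using matrix_left_invertible_ker[of G] by blast
  then have H': "G ** H = mat 1"
    by (simp add: matrix_left_right_inverse)
  have "v \<bullet> ((transpose ?L ** G) *v w) = v \<bullet> ((- (G ** ?L)) *v w)" for v w
  proof -
    have "v \<bullet> ((transpose ?L ** G) *v w) = (?L *v v) \<bullet> (G *v w)"
      by (metis dot_lmul_matrix inner_commute matrix_vector_mul_assoc transpose_matrix_vector)
    also have "\<dots> = - (v \<bullet> (G *v (?L *v w)))"
      using skew[of v w] by (simp only: g L)
    also have "\<dots> = v \<bullet> (- ((G ** ?L) *v w))"
      by (simp only: matrix_vector_mul_assoc inner_minus_right)
    also have "- ((G ** ?L) *v w) = (- (G ** ?L)) *v w"
      by (simp add: matrix_vector_mult_def vec_eq_iff sum_negf)
    finally show ?thesis .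
  qed
  then have *: "transpose ?L ** G = - (G ** ?L)"
    by (metis matrix_eq vector_eq_ldot)
  have "trace ?L = trace (H ** (G ** ?L))"
    by (simp add: matrix_mul_assoc H)
  also have "\<dots> = trace ((G ** ?L) ** H)"
    by (rule trace_mul_sym)
  also have "G ** ?L = - (transpose ?L ** G)"
    using * by simp
  also have "trace (- (transpose ?L ** G) ** H) = - trace (transpose ?L ** (G ** H))"
    unfolding matrix_mul_assoc by (simp add: trace_def matrix_matrix_mult_def sum_negf)
  also have "\<dots> = - trace ?L"
    by (simp add: H' trace_def transpose_def)
  finally show ?thesis
    by simp
qed

section \<open>The generalized symmetric metric connection of a Kenmotsu manifold\<close>

text \<open>The Levi-Civita connection stands under an existential quantifier in
  \<open>kenmotsu\<close>; here it is fixed as \<open>nabla\<close>.\<close>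

locale kenmotsu_connection =
  fixes A :: "('a::{t2_space, second_countable_topology}, 'm::finite) chart set"
    and \<phi> :: "'a \<Rightarrow> real ^ 'm \<Rightarrow> real ^ 'm"
    and \<xi> :: "('a, 'm) field"
    and \<eta> :: "'a \<Rightarrow> real ^ 'm \<Rightarrow> real"
    and g :: "'a \<Rightarrow> real ^ 'm \<Rightarrow> real ^ 'm \<Rightarrow> real"
    and nabla D :: "('a, 'm) connection"
    and \<alpha> \<beta> :: "'a \<Rightarrow> real"
  assumes almost_contact_metric: "almost_contact_metric A \<phi> \<xi> \<eta> g"
    and levi_civita: "levi_civita A g nabla"
    and nabla_xi: "\<And>X p. vector_field A X \<Longrightarrow> nabla X \<xi> p = X p - \<eta> p (X p) *\<^sub>R \<xi> p"
    and smooth_alpha: "smooth_fun A \<alpha>"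
    and smooth_beta: "smooth_fun A \<beta>"
    and connection: "generalized_symmetric_metric_connection A \<phi> \<eta> g \<alpha> \<beta> D"
begin

section \<open>Pointwise identities of the structure tensors\<close>

lemma manifold: "smooth_manifold A"
  using almost_contact_metric by (simp add: almost_contact_metric_def)

lemma
  shows xi_field: "vector_field A \<xi>"
    and phi_xi: "\<phi> p (\<xi> p) = 0"
    and eta_phi: "\<eta> p (\<phi> p v) = 0"
    and eta_xi: "\<eta> p (\<xi> p) = 1"
    and phi_phi: "\<phi> p (\<phi> p v) = - v + \<eta> p v *\<^sub>R \<xi> p"
    and g_phi_phi: "g p (\<phi> p v) (\<phi> p w) = g p v w - \<eta> p v * \<eta> p w"
    and g_xi: "g p v (\<xi> p) = \<eta> p v"
    and linear_phi: "linear (\<phi> p)"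
    and phi_field: "vector_field A X \<Longrightarrow> vector_field A (\<lambda>p. \<phi> p (X p))"
    and linear_eta: "linear (\<eta> p)"
    and smooth_eta: "vector_field A X \<Longrightarrow> smooth_fun A (\<lambda>p. \<eta> p (X p))"
    and bilinear_g: "bilinear (g p)"
    and g_commute: "g p v w = g p w v"
    and g_pos: "v \<noteq> 0 \<Longrightarrow> g p v v > 0"
    and smooth_g: "vector_field A X \<Longrightarrow> vector_field A Y \<Longrightarrow> smooth_fun A (\<lambda>p. g p (X p) (Y p))"
  using almost_contact_metric
  by (auto simp: almost_contact_metric_def riemannian_metric_def one_form_def endo_field_def)

lemma xi_g: "g p (\<xi> p) v = \<eta> p v"
  using g_xi g_commute by metis

lemmas eta_simps = linear_add[OF linear_eta] linear_diff[OF linear_eta] linear_neg[OF linear_eta]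
  linear_scale[OF linear_eta] linear_0[OF linear_eta]

lemmas phi_simps = linear_add[OF linear_phi] linear_diff[OF linear_phi] linear_neg[OF linear_phi]
  linear_scale[OF linear_phi] linear_0[OF linear_phi]

lemmas g_simps = bilinear_ladd[OF bilinear_g] bilinear_radd[OF bilinear_g]
  bilinear_lsub[OF bilinear_g] bilinear_rsub[OF bilinear_g]
  bilinear_lneg[OF bilinear_g] bilinear_rneg[OF bilinear_g]
  bilinear_lmul[OF bilinear_g] bilinear_rmul[OF bilinear_g]
  bilinear_lzero[OF bilinear_g] bilinear_rzero[OF bilinear_g]

lemmas tensor_simps = eta_simps phi_simps g_simps eta_xi phi_xi eta_phi phi_phi g_xi xi_g

text \<open>Insert \<open>\<phi> p v\<close> into the compatibility of \<open>g\<close> with \<phi>;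
  the terms with \<xi> vanish since \<open>\<eta> p\<close> is zero on the range of
  \<open>\<phi> p\<close>.\<close>

lemma phi_skew: "g p (\<phi> p v) w = - g p v (\<phi> p w)"
  using g_phi_phi[of p "\<phi> p v" w] by (simp add: tensor_simps)

lemma g_phi_self: "g p (\<phi> p v) v = 0"
  using phi_skew[of p v v] g_commute[of p v "\<phi> p v"] by simp

lemmas field_intros = vector_field_add[OF manifold] vector_field_scale[OF manifold]
  vector_field_diff[OF manifold] smooth_fun_const[OF manifold] smooth_fun_add[OF manifold]
  smooth_fun_mult[OF manifold] smooth_fun_uminus[OF manifold] smooth_fun_diff[OF manifold]
  xi_field phi_field smooth_eta smooth_g smooth_alpha smooth_beta

text \<open>The difference of the two fields is itself an admissible test field, so positivity of
  \<open>g\<close> applies directly.\<close>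

lemma field_eqI:
  assumes "vector_field A X" "vector_field A Y"
    and "\<And>Z. vector_field A Z \<Longrightarrow> g p (X p) (Z p) = g p (Y p) (Z p)"
  shows "X p = Y p"
  using assms(3)[OF vector_field_diff[OF manifold assms(1,2)]] g_pos[of "X p - Y p" p]
  by (force simp: g_simps)

section \<open>Comparison with the Levi-Civita connection\<close>

lemma
  shows D_linear: "linear_connection A D" and D_metric: "metric_compatible A g D"
    and D_torsion: "vector_field A X \<Longrightarrow> vector_field A Y \<Longrightarrow> torsion A D X Y p =
          \<alpha> p *\<^sub>R (\<eta> p (Y p) *\<^sub>R X p - \<eta> p (X p) *\<^sub>R Y p) +
          \<beta> p *\<^sub>R (\<eta> p (Y p) *\<^sub>R \<phi> p (X p) - \<eta> p (X p) *\<^sub>R \<phi> p (Y p))"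
  using connection by (auto simp: generalized_symmetric_metric_connection_def)

lemma
  shows nabla_linear: "linear_connection A nabla" and nabla_metric: "metric_compatible A g nabla"
    and nabla_torsion: "vector_field A X \<Longrightarrow> vector_field A Y \<Longrightarrow> torsion A nabla X Y p = 0"
  using levi_civita by (auto simp: levi_civita_def)

lemma
  assumes "vector_field A X" "vector_field A Y"
  shows D_field: "vector_field A (D X Y)" and nabla_field: "vector_field A (nabla X Y)"
  using D_linear nabla_linear assms by (auto simp: linear_connection_def)

lemma
  assumes "vector_field A X" "vector_field A Y"
  shows D_scale_left: "smooth_fun A f \<Longrightarrow> D (\<lambda>p. f p *\<^sub>R X p) Y = (\<lambda>p. f p *\<^sub>R D X Y p)"
    and D_scale_right: "smooth_fun A f \<Longrightarrow>
      D X (\<lambda>p. f p *\<^sub>R Y p) = (\<lambda>p. field_deriv A X f p *\<^sub>R Y p + f p *\<^sub>R D X Y p)"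
    and D_add_right: "vector_field A Z \<Longrightarrow> D X (\<lambda>p. Y p + Z p) = (\<lambda>p. D X Y p + D X Z p)"
  using D_linear assms by (auto simp: linear_connection_def)

lemma D_metricD:
  assumes "vector_field A X" "vector_field A Y" "vector_field A Z"
  shows "field_deriv A X (\<lambda>q. g q (Y q) (Z q)) p = g p (D X Y p) (Z p) + g p (Y p) (D X Z p)"
  using D_metric assms by (auto simp: metric_compatible_def)

lemma nabla_metricD:
  assumes "vector_field A X" "vector_field A Y" "vector_field A Z"
  shows "field_deriv A X (\<lambda>q. g q (Y q) (Z q)) p = g p (nabla X Y p) (Z p) + g p (Y p) (nabla X Z p)"
  using nabla_metric assms by (auto simp: metric_compatible_def)

text \<open>The difference \<open>E\<close> of the two sides is symmetric in \<open>X\<close>, \<open>Y\<close>, and \<open>g (E X Y) Z\<close> is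
  skew in \<open>Y\<close>, \<open>Z\<close>, so \<open>E = 0\<close>.\<close>

lemma D_eq:
  assumes X: "vector_field A X" and Y: "vector_field A Y"
  shows "D X Y p = nabla X Y p + \<alpha> p *\<^sub>R (\<eta> p (Y p) *\<^sub>R X p - g p (X p) (Y p) *\<^sub>R \<xi> p)
    - (\<beta> p * \<eta> p (X p)) *\<^sub>R \<phi> p (Y p)"
proof -
  define C where "C X Y p = nabla X Y p + \<alpha> p *\<^sub>R (\<eta> p (Y p) *\<^sub>R X p - g p (X p) (Y p) *\<^sub>R \<xi> p)
    - (\<beta> p * \<eta> p (X p)) *\<^sub>R \<phi> p (Y p)" for X Y p
  define E where "E X Y p = D X Y p - C X Y p" for X Y p
  have C_field: "vector_field A (C X Y)" if "vector_field A X" "vector_field A Y" for X Y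
    unfolding C_def[abs_def] using that by (intro field_intros nabla_field)
  have skew: "g p (E X Y p) (Z p) = - g p (E X Z p) (Y p)"
    if "vector_field A X" "vector_field A Y" "vector_field A Z" for X Y Z
    \<comment> \<open>Both connections are metric, and the correction terms in \<open>C\<close> are
      skew in \<open>Y\<close> and \<open>Z\<close>, the one with \<beta> because \<phi> is
      skew.\<close>
    using D_metricD[OF that, of p] nabla_metricD[OF that, of p] phi_skew[of p "Y p" "Z p"]
      g_commute[of p "Y p"]
    by (simp add: E_def C_def tensor_simps algebra_simps)
  have sym: "E X Y p = E Y X p" if "vector_field A X" "vector_field A Y" for X Y
    \<comment> \<open>The correction terms in \<open>C\<close> have exactly the torsion prescribed
      for \<open>D\<close>, while \<open>nabla\<close> has none.\<close>
    using D_torsion[OF that, of p] nabla_torsion[OF that, of p] g_commute[of p "Y p" "X p"]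
    by (simp add: E_def C_def torsion_def algebra_simps)
  have "D X Y p = C X Y p"
  proof (rule field_eqI[OF D_field[OF X Y] C_field[OF X Y]])
    fix Z assume Z: "vector_field A Z"
    have "g p (E X Y p) (Z p) = - g p (E X Y p) (Z p)"
      using skew[OF X Y Z] skew[OF Z X Y] skew[OF Y Z X]
      unfolding sym[OF X Y] sym[OF Y Z] sym[OF Z X] by linarith
    then show "g p (D X Y p) (Z p) = g p (C X Y p) (Z p)"
      by (simp add: E_def g_simps)
  qed
  then show ?thesis
    by (simp add: C_def)
qed

lemma D_xi: "vector_field A X \<Longrightarrow> D X \<xi> p = (1 + \<alpha> p) *\<^sub>R (X p - \<eta> p (X p) *\<^sub>R \<xi> p)"
  by (simp add: D_eq xi_field nabla_xi tensor_simps algebra_simps)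

lemma D_xi_xi: "D \<xi> \<xi> p = 0"
  by (simp add: D_xi xi_field tensor_simps)

text \<open>\<open>lie_bracket\<close> is a definite description; that \<open>nabla\<close> is
  torsion-free rewrites it as a difference of smooth fields.\<close>

lemma bracket_field:
  assumes "vector_field A X" "vector_field A Y"
  shows "vector_field A (lie_bracket A X Y)"
proof -
  have "lie_bracket A X Y = (\<lambda>p. nabla X Y p - nabla Y X p)"
    using nabla_torsion[OF assms] by (simp add: fun_eq_iff torsion_def)
  then show ?thesis
    using assms by (simp add: field_intros nabla_field)
qed

section \<open>Curvature and Ricci tensor in the direction of \<xi>\<close>

lemma curvature_field:
  assumes "vector_field A X" "vector_field A Y" "vector_field A Z"
  shows "vector_field A (curvature A D X Y Z)"
  unfolding curvature_def[abs_def] by (intro field_intros D_field bracket_field assms)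

lemma curvature_skew:
  assumes "vector_field A X" "vector_field A Y" "vector_field A Z"
  shows "curvature A D X Y Z p = - curvature A D Y X Z p"
proof -
  have "lie_bracket A X Y q = - lie_bracket A Y X q" for q
    using nabla_torsion[OF assms(1,2), of q] nabla_torsion[OF assms(2,1), of q]
    unfolding torsion_def by (metis minus_diff_eq right_minus_eq)
  then have "lie_bracket A X Y = (\<lambda>p. (- 1) *\<^sub>R lie_bracket A Y X p)"
    by (simp add: fun_eq_iff)
  then have "D (lie_bracket A X Y) Z = (\<lambda>p. (- 1) *\<^sub>R D (lie_bracket A Y X) Z p)"
    using D_scale_left[OF bracket_field[OF assms(2,1)] assms(3) smooth_fun_const[OF manifold], of "- 1"]
    by simp
  then show ?thesis
    by (simp add: curvature_def)
qed

text \<open>Let \<open>PX\<close> be the part of \<open>X\<close> orthogonal to \<xi>. Then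
  \<open>D X \<xi>\<close> is \<open>1 + \<alpha>\<close> times \<open>PX\<close>, and the Leibniz
  rule produces the derivative of \<open>1 + \<alpha>\<close> along \<xi>. The terms with
  \<open>D \<xi> PX\<close> cancel against those of the bracket.\<close>

lemma curvature_xi:
  assumes X: "vector_field A X"
  shows "curvature A D \<xi> X \<xi> p =
    (field_deriv A \<xi> (\<lambda>q. 1 + \<alpha> q) p + 1 + \<alpha> p) *\<^sub>R (X p - \<eta> p (X p) *\<^sub>R \<xi> p)
    - ((1 + \<alpha> p) * \<beta> p) *\<^sub>R \<phi> p (X p)"
proof -
  define PX where "PX p = X p + (- \<eta> p (X p)) *\<^sub>R \<xi> p" for p
  have PX: "vector_field A PX"
    unfolding PX_def[abs_def] using X by (intro field_intros)
  have f: "smooth_fun A (\<lambda>q. 1 + \<alpha> q)"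
    by (intro field_intros)
  define h where "h = field_deriv A \<xi> (\<lambda>q. - \<eta> q (X q)) p"
  have "D \<xi> PX = (\<lambda>q. D \<xi> X q + D \<xi> (\<lambda>q. (- \<eta> q (X q)) *\<^sub>R \<xi> q) q)"
    unfolding PX_def[abs_def] by (intro D_add_right field_intros X)
  then have D_PX: "D \<xi> PX p = D \<xi> X p + h *\<^sub>R \<xi> p"
    using D_scale_right[OF xi_field xi_field smooth_fun_uminus[OF manifold smooth_eta[OF X]]]
    by (simp add: D_xi_xi h_def)
  \<comment> \<open>Since \<open>D \<xi> \<xi>\<close> vanishes, differentiating along \<xi>
    preserves orthogonality to \<xi>. This determines \<open>h\<close>.\<close>
  have "(\<lambda>q. g q (PX q) (\<xi> q)) = (\<lambda>q. 0)"
    by (simp add: PX_def tensor_simps)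
  then have "\<eta> p (D \<xi> PX p) = 0"
    using D_metricD[OF xi_field PX xi_field, of p] field_deriv_const[OF manifold, of \<xi> 0 p]
    by (simp add: D_xi_xi tensor_simps)
  then have h: "h = - \<eta> p (D \<xi> X p)"
    by (simp add: D_PX tensor_simps)
  have "D X \<xi> = (\<lambda>q. (1 + \<alpha> q) *\<^sub>R PX q)"
    using D_xi[OF X] by (simp add: fun_eq_iff PX_def)
  then have 1: "D \<xi> (D X \<xi>) p = field_deriv A \<xi> (\<lambda>q. 1 + \<alpha> q) p *\<^sub>R PX p
      + (1 + \<alpha> p) *\<^sub>R D \<xi> PX p"
    using D_scale_right[OF xi_field PX f] by simp
  \<comment> \<open>Writing the zero field as \<open>0\<close> times \<xi> lets the Leibniz rule
    show that its covariant derivative is zero.\<close>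
  have "D \<xi> \<xi> = (\<lambda>q. 0 *\<^sub>R \<xi> q)"
    by (simp add: fun_eq_iff D_xi_xi)
  then have 2: "D X (D \<xi> \<xi>) p = 0"
    using D_scale_right[OF X xi_field smooth_fun_const[OF manifold], of 0] field_deriv_const[OF manifold]
    by simp
  have "lie_bracket A \<xi> X p = D \<xi> X p - D X \<xi> p + \<alpha> p *\<^sub>R (X p - \<eta> p (X p) *\<^sub>R \<xi> p) + \<beta> p *\<^sub>R \<phi> p (X p)"
    using D_torsion[OF xi_field X, of p] by (simp add: torsion_def tensor_simps algebra_simps)
  \<comment> \<open>The torsion term with \<alpha> cancels the \<alpha> in \<open>D X \<xi>\<close>,
    so \<open>PX\<close> keeps the coefficient 1.\<close>
  then have "lie_bracket A \<xi> X p = D \<xi> X p - PX p + \<beta> p *\<^sub>R \<phi> p (X p)"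
    by (simp add: D_xi[OF X] PX_def algebra_simps)
  then have 3: "D (lie_bracket A \<xi> X) \<xi> p
      = (1 + \<alpha> p) *\<^sub>R (D \<xi> PX p - PX p + \<beta> p *\<^sub>R \<phi> p (X p))"
    by (simp add: D_xi[OF bracket_field[OF xi_field X]] D_PX h PX_def tensor_simps)
  show ?thesis
    unfolding curvature_def 1 2 3 by (simp add: PX_def algebra_simps)
qed

text \<open>This is the skewness of the curvature of a metric connection, with \<xi> in one slot. As
  \<open>Z\<close> is orthogonal to \<xi> everywhere, the function \<open>g Z \<xi>\<close> is
  identically zero, and no second derivatives of it have to be commuted.\<close>

lemma eta_curvature_xi:
  assumes X: "vector_field A X" and Z: "vector_field A Z" and eta_Z: "\<And>q. \<eta> q (Z q) = 0"
  shows "\<eta> p (curvature A D \<xi> X Z p) = - g p (curvature A D \<xi> X \<xi> p) (Z p)"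
proof -
  have swap: "\<eta> q (D Y Z q) = - g q (Z q) (D Y \<xi> q)" if Y: "vector_field A Y" for Y q
    using D_metricD[OF Y Z xi_field, of q] field_deriv_const[OF manifold, of Y 0 q]
    by (simp add: eta_Z g_xi)
  have 1: "\<eta> p (D Y (D W Z) p) = field_deriv A Y (\<lambda>q. - g q (Z q) (D W \<xi> q)) p - g p (D W Z p) (D Y \<xi> p)"
    if "vector_field A Y" "vector_field A W" for Y W
    using D_metricD[OF that(1) D_field[OF that(2) Z] xi_field, of p]
    by (simp add: swap[OF that(2)] g_xi)
  have 2: "field_deriv A Y (\<lambda>q. - g q (Z q) (D W \<xi> q)) p
      = - g p (D Y Z p) (D W \<xi> p) - g p (Z p) (D Y (D W \<xi>) p)"
    if Y: "vector_field A Y" and W: "vector_field A W" for Y W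
  proof -
    \<comment> \<open>The sign is absorbed into the field, so that metric compatibility applies to
      the function as it stands.\<close>
    let ?V = "\<lambda>q. (- 1) *\<^sub>R D W \<xi> q"
    have V: "vector_field A ?V"
      by (intro field_intros D_field W)
    have "D Y ?V p = - D Y (D W \<xi>) p"
      using D_scale_right[OF Y D_field[OF W xi_field] smooth_fun_const[OF manifold], of "- 1"]
        field_deriv_const[OF manifold] by simp
    then show ?thesis
      using D_metricD[OF Y Z V, of p] by (simp add: g_simps)
  qed
  \<comment> \<open>The mixed terms, products of a derivative of \<open>Z\<close> and one of \<xi>,
    cancel or contain \<open>D \<xi> \<xi>\<close>.\<close>
  show ?thesis
    using 1[OF xi_field X] 1[OF X xi_field] 2[OF xi_field X] 2[OF X xi_field]
      swap[OF bracket_field[OF xi_field X], of p]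
    by (simp add: curvature_def tensor_simps D_xi_xi g_commute[of p _ "Z p"])
qed

text \<open>The endomorphism to be traced combines \<phi>, of trace 0 by skewness, with the
  projection along \<xi>, of trace one less than the dimension.\<close>

lemma ricci_xi_xi:
  "ricci A D \<xi> \<xi> p = - (real CARD('m) - 1) * (field_deriv A \<xi> (\<lambda>q. 1 + \<alpha> q) p + 1 + \<alpha> p)"
proof -
  define c where "c = field_deriv A \<xi> (\<lambda>q. 1 + \<alpha> q) p + 1 + \<alpha> p"
  define L where "L v = ((1 + \<alpha> p) * \<beta> p) *\<^sub>R \<phi> p v - c *\<^sub>R (v - \<eta> p v *\<^sub>R \<xi> p)" for v
  have L: "linear L"
    by (rule linearI) (simp_all add: L_def tensor_simps algebra_simps)
  have curv: "curvature A D X \<xi> \<xi> p = L (X p)" if "vector_field A X" for X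
    by (simp add: curvature_skew[OF that xi_field xi_field] curvature_xi[OF that] L_def c_def)
  have "endo_at A (\<lambda>X. curvature A D X \<xi> \<xi>) p = L"
    unfolding endo_at_def
  proof (rule the_equality)
    show "linear L \<and> (\<forall>X. vector_field A X \<longrightarrow> curvature A D X \<xi> \<xi> p = L (X p))"
      using L curv by blast
    fix L' assume *: "linear L' \<and> (\<forall>X. vector_field A X \<longrightarrow> curvature A D X \<xi> \<xi> p = L' (X p))"
    \<comment> \<open>Every tangent vector at \<open>p\<close> is the value of a global field, so
      the description in \<open>endo_at\<close> has only one solution.\<close>
    show "L' = L"
    proof
      fix v
      obtain X where "vector_field A X" "X p = v"
        using vector_field_through[OF manifold] by blast
      then show "L' v = L v"
        using * curv by metis
    qed
  qed
  then have "ricci A D \<xi> \<xi> p = trace (matrix L)"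
    by (simp add: ricci_def)
  also have "\<dots> = (1 + \<alpha> p) * \<beta> p * trace (matrix (\<phi> p))
      - c * (real CARD('m) - (\<Sum>i\<in>UNIV. \<xi> p $ i * \<eta> p (axis i 1)))"
    by (simp add: trace_matrix L_def sum_subtractf sum_distrib_left algebra_simps sum.distrib)
  also have "trace (matrix (\<phi> p)) = 0"
    using bilinear_g g_pos linear_phi phi_skew by (rule trace_skew_adjoint)
  \<comment> \<open>The trace of the rank one map sending \<open>v\<close> to
    \<open>\<eta> p v *\<^sub>R \<xi> p\<close> is \<open>\<eta> p (\<xi> p)\<close>.\<close>
  also have "(\<Sum>i\<in>UNIV. \<xi> p $ i * \<eta> p (axis i 1)) = 1"
    using linear_basis_expansion[OF linear_eta, of p "\<xi> p"] by (simp add: eta_xi)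
  finally show ?thesis
    by (simp add: c_def algebra_simps)
qed

lemma exists_orthogonal:
  assumes "CARD('m) > 1"
  shows "\<exists>v. v \<noteq> 0 \<and> \<eta> p v = 0"
proof (rule ccontr)
  assume *: "\<not> ?thesis"
  have "v \<in> span {\<xi> p}" for v
  proof -
    have "\<eta> p (v - \<eta> p v *\<^sub>R \<xi> p) = 0"
      by (simp add: tensor_simps)
    then have "v - \<eta> p v *\<^sub>R \<xi> p = 0"
      using * by blast
    then have "v = \<eta> p v *\<^sub>R \<xi> p"
      by simp
    then show ?thesis
      by (metis span_base span_scale singletonI)
  qed
  then have "UNIV \<subseteq> span {\<xi> p}"
    by auto
  then have "dim (UNIV :: (real ^ 'm) set) \<le> card {\<xi> p}"
    by (rule dim_le_card) simp
  then show False
    using assms by simp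
qed

end

section \<open>Solitons\<close>

locale kenmotsu_soliton = kenmotsu_connection A \<phi> \<xi> \<eta> g nabla D \<alpha> \<beta>
  for A :: "('a::{t2_space, second_countable_topology}, 'm::finite) chart set"
    and \<phi> \<xi> \<eta> g nabla D \<alpha> \<beta> +
  fixes lam mu :: real
  assumes soliton: "eta_ricci_soliton A \<xi> \<eta> g D lam mu"
begin

lemma ricci_eq:
  assumes "vector_field A X" "vector_field A Y"
  shows "ricci A D X Y p =
    - (1 + \<alpha> p + lam) * g p (X p) (Y p) + (1 + \<alpha> p - mu) * \<eta> p (X p) * \<eta> p (Y p)"
proof -
  have "g p (D X \<xi> p) (Y p) + g p (X p) (D Y \<xi> p) + 2 * ricci A D X Y p +
      2 * lam * g p (X p) (Y p) + 2 * mu * \<eta> p (X p) * \<eta> p (Y p) = 0"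
    using soliton assms by (auto simp: eta_ricci_soliton_def)
  then show ?thesis
    by (simp add: D_xi assms tensor_simps algebra_simps)
qed

text \<open>The right-hand side is read off from \<open>ricci_eq\<close>; the uniqueness demanded by
  the definite description is \<open>field_eqI\<close>.\<close>

lemma ricci_operator_eq:
  assumes X: "vector_field A X"
  shows "ricci_operator A g D X =
    (\<lambda>p. - (1 + \<alpha> p + lam) *\<^sub>R X p + ((1 + \<alpha> p - mu) * \<eta> p (X p)) *\<^sub>R \<xi> p)"
    (is "_ = ?Q")
  unfolding ricci_operator_def
proof (rule the_equality)
  have Q: "vector_field A ?Q"
    using X by (intro field_intros)
  have gQ: "g p (?Q p) (Y p) = ricci A D X Y p" if "vector_field A Y" for Y p
    by (simp add: ricci_eq[OF X that] tensor_simps)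
  show "vector_field A ?Q \<and> (\<forall>Y p. vector_field A Y \<longrightarrow> g p (?Q p) (Y p) = ricci A D X Y p)"
    using Q gQ by blast
  fix W assume "vector_field A W \<and> (\<forall>Y p. vector_field A Y \<longrightarrow> g p (W p) (Y p) = ricci A D X Y p)"
  then have "W p = ?Q p" for p
    using gQ by (intro field_eqI Q) auto
  then show "W = ?Q"
    by (simp add: fun_eq_iff)
qed

section \<open>Evaluation of the condition on the W_2 tensor\<close>

lemma W2_field:
  assumes "vector_field A X" "vector_field A Y" "vector_field A Z"
  shows "vector_field A (W2_curvature A g D X Y Z)"
  unfolding W2_curvature_def[abs_def] ricci_operator_eq[OF assms(1)] ricci_operator_eq[OF assms(2)]
  by (intro field_intros curvature_field assms)

lemma lam_mu: "lam + mu = (real CARD('m) - 1) * (field_deriv A \<xi> (\<lambda>q. 1 + \<alpha> q) p + 1 + \<alpha> p)"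
  using ricci_eq[OF xi_field xi_field, of p] ricci_xi_xi[of p]
  by (simp add: tensor_simps algebra_simps)

lemma alpha_cases:
  assumes W2_S: "\<And>X Y Z p. vector_field A X \<Longrightarrow> vector_field A Y \<Longrightarrow> vector_field A Z \<Longrightarrow>
      ricci A D (W2_curvature A g D \<xi> X Y) Z p + ricci A D Y (W2_curvature A g D \<xi> X Z) p = 0"
    and "CARD('m) > 1"
  shows "(1 + \<alpha> p + lam) * (1 + \<alpha> p - mu) = 0"
proof -
  define N where "N = real CARD('m) - 1"
  have N: "N > 0"
    using assms(2) by (simp add: N_def)
  define c where "c = field_deriv A \<xi> (\<lambda>q. 1 + \<alpha> q) p + 1 + \<alpha> p"
  have lm: "lam + mu = N * c"
    using lam_mu[of p] by (simp add: N_def c_def)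
  obtain v where v: "v \<noteq> 0" "\<eta> p v = 0"
    using exists_orthogonal[OF assms(2), of p] by auto
  obtain V where V: "vector_field A V" "V p = v"
    using vector_field_through[OF manifold] by blast
  \<comment> \<open>Projecting makes \<open>X\<close> orthogonal to \<xi> at all points, as
    \<open>eta_curvature_xi\<close> demands, and keeps the value \<open>v\<close> at
    \<open>p\<close>.\<close>
  define X where "X q = V q - \<eta> q (V q) *\<^sub>R \<xi> q" for q
  have X: "vector_field A X"
    unfolding X_def[abs_def] by (intro field_intros V)
  have Xp: "X p = v"
    by (simp add: X_def V v)
  have eta_X: "\<eta> q (X q) = 0" for q
    by (simp add: X_def tensor_simps)
  define a where "a = 1 + \<alpha> p + lam"
  have R: "curvature A D \<xi> X \<xi> p = c *\<^sub>R v - ((1 + \<alpha> p) * \<beta> p) *\<^sub>R \<phi> p v"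
    by (simp add: curvature_xi[OF X] c_def Xp v)
  \<comment> \<open>Here the bracket in W_2 reduces to the Ricci operator on \<open>X\<close>, which
    is \<open>- a\<close> times \<open>v\<close> at \<open>p\<close>; the \<phi>-term is orthogonal
    to \<open>v\<close>.\<close>
  have W_xi: "g p (W2_curvature A g D \<xi> X \<xi> p) v = (c - a / N) * g p v v"
    "\<eta> p (W2_curvature A g D \<xi> X \<xi> p) = 0"
    unfolding W2_curvature_def R
    by (simp_all add: ricci_operator_eq X xi_field tensor_simps Xp v g_phi_self a_def N_def algebra_simps add_divide_distrib)
  \<comment> \<open>The Ricci operator sends \<xi> to \<open>- (lam + mu)\<close> times \<xi>. By
    \<open>lm\<close> this cancels the curvature term, so the second summand of the condition
    vanishes.\<close>
  have "\<eta> p (W2_curvature A g D \<xi> X X p) = (- c + (lam + mu) / N) * g p v v"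
    unfolding W2_curvature_def
    by (simp add: ricci_operator_eq X xi_field tensor_simps eta_curvature_xi[OF X X eta_X] R
        Xp v g_phi_self N_def algebra_simps add_divide_distrib)
  then have "\<eta> p (W2_curvature A g D \<xi> X X p) = 0"
    using N by (simp add: lm)
  then have "a * (c - a / N) * g p v v = 0"
    using W2_S[OF X xi_field X, of p] W_xi
    by (auto simp: ricci_eq W2_field X xi_field tensor_simps Xp v a_def)
  then have "a * (N * c - a) = 0"
    using g_pos[OF v(1), of p] N by (auto simp: field_simps)
  \<comment> \<open>By \<open>lm\<close>, the factor \<open>N * c - a\<close> equals
    \<open>mu - (1 + \<alpha> p)\<close>.\<close>
  then show ?thesis
    by (auto simp: lm[symmetric] a_def)
qed

lemma soliton_equation:
  assumes W2_S: "\<And>X Y Z p. vector_field A X \<Longrightarrow> vector_field A Y \<Longrightarrow> vector_field A Z \<Longrightarrow>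
      ricci A D (W2_curvature A g D \<xi> X Y) Z p + ricci A D Y (W2_curvature A g D \<xi> X Z) p = 0"
    and dim: "CARD('m) = 2 * n + 1"
  shows "(\<alpha> p + 1 - mu) * (- 2 * mu - 2 * lam + (4 * \<alpha> p + 4) * real n) = 0"
\<comment> \<open>In dimension 1 no nonzero vector is orthogonal to \<xi>, but then
  \<open>lam_mu\<close> gives \<open>lam + mu = 0\<close> and the second factor vanishes.\<close>
proof (cases "n = 0 \<or> \<alpha> p + 1 = mu")
  case True
  then show ?thesis
    using lam_mu[of p] dim by auto
next
  case False
  \<comment> \<open>At \<open>p\<close> the value \<open>mu\<close> is excluded, so
    \<open>1 + \<alpha> p = - lam\<close>; at any \<open>q\<close> the only values are
    \<open>- lam\<close> and \<open>mu\<close>.\<close>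
  have "1 + \<alpha> q = 1 + \<alpha> p \<or> 1 + \<alpha> q = mu" for q
    using alpha_cases[OF W2_S, of p] alpha_cases[OF W2_S, of q] dim False by auto
  then have "field_deriv A \<xi> (\<lambda>q. 1 + \<alpha> q) p = 0"
    by (intro field_deriv_two_valued[OF manifold] field_intros)
  then have "lam + mu = 2 * real n * (1 + \<alpha> p)"
    using lam_mu[of p] dim by simp
  then have "- 2 * mu - 2 * lam + (4 * \<alpha> p + 4) * real n = 0"
    by (simp add: algebra_simps)
  then show ?thesis
    by simp
qed

end

theorem theorem9p1:
  fixes A :: "('a::{t2_space, second_countable_topology}, 'm::finite) chart set"
    and \<phi> :: "'a \<Rightarrow> real ^ 'm \<Rightarrow> real ^ 'm"
    and \<xi> :: "('a, 'm) field"
    and \<eta> :: "'a \<Rightarrow> real ^ 'm \<Rightarrow> real"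
    and g :: "'a \<Rightarrow> real ^ 'm \<Rightarrow> real ^ 'm \<Rightarrow> real"
    and D :: "('a, 'm) connection"
    and \<alpha> \<beta> :: "'a \<Rightarrow> real"
    and lam mu :: real
    and n :: nat
  assumes dim: "CARD('m) = 2 * n + 1"
    and kenmotsu: "kenmotsu A \<phi> \<xi> \<eta> g"
    and smooth: "smooth_fun A \<alpha>" "smooth_fun A \<beta>"
    and connection: "generalized_symmetric_metric_connection A \<phi> \<eta> g \<alpha> \<beta> D"
    and soliton: "eta_ricci_soliton A \<xi> \<eta> g D lam mu"
    and W2_S: "\<And>X Y Z p. vector_field A X \<Longrightarrow> vector_field A Y \<Longrightarrow> vector_field A Z \<Longrightarrow>
      ricci A D (W2_curvature A g D \<xi> X Y) Z p + ricci A D Y (W2_curvature A g D \<xi> X Z) p = 0"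
  shows "\<forall>p. (\<alpha> p + 1 - mu) * (- 2 * mu - 2 * lam + (4 * \<alpha> p + 4) * real n) = 0"
proof -
  obtain nabla where nabla: "levi_civita A g nabla"
      "\<And>X p. vector_field A X \<Longrightarrow> nabla X \<xi> p = X p - \<eta> p (X p) *\<^sub>R \<xi> p"
    using kenmotsu by (auto simp: kenmotsu_def)
  interpret kenmotsu_soliton A \<phi> \<xi> \<eta> g nabla D \<alpha> \<beta> lam mu
    using kenmotsu nabla smooth connection soliton by unfold_locales (auto simp: kenmotsu_def)
  show ?thesis
    using soliton_equation[OF W2_S dim] by blast
qed

end
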